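(* Let $f,g\colon\mathbb{C}\to\mathbb{C}$ be nonconstant entire functions with $g(0)=0$. Assume that there exist $z_0\in\mathbb{C}$ and a strictly increasing sequence $(n_k)_{k\in\mathbb{N}}$ of natural numbers with $f^{n_k}(z_0)\to\infty$ as $k\to\infty$. Then there exists an entire function $h\colon\mathbb{C}\to\mathbb{C}$ such that the point $(z_0,0)$ belongs to the Julia set (for each of the three notions of normality: $\widehat{\mathbb{C}^2}$, $\mathbf{P}_2\mathbb{C}$ and $\widehat{\mathbb{C}}\times\widehat{\mathbb{C}}$) of the skew-product $F\colon\mathbb{C}^2\to\mathbb{C}^2$ defined by $$F(z,w)=(f(z)+w\,h(z),\,g(w)).$$
   Context: $f^n$ denotes the $n$-th iterate; $\mathbb{N}$ includes $0$. Let $X$ be a complex manifold and let $\mathcal{F}$ be a family of holomorphic maps $X\to\mathbb{C}^2$. - $\mathcal{F}$ is $\widehat{\mathbb{C}^2}$-normal if every sequence in $\mathcal{F}$ either diverges uniformly to infinity on compact subsets of $X$ or has a subsequence converging uniformly on compact subsets to a holomorphic map $X\to\mathbb{C}^2$. (Here $\widehat{\mathbb{C}^2}$ is the one-point compactification.) - $\mathcal{F}$ is $\mathbf{P}_2\mathbb{C}$-normal if every sequence in $\mathcal{F}$ has a subsequence converging uniformly on compact subsets to a holomorphic map $X\to\mathbf{P}_2\mathbb{C}$ (with $\mathbb{C}^2\subset\mathbf{P}_2\mathbb{C}$ the complex projective plane). - $\mathcal{F}$ is $(\widehat{\mathbb{C}})^2$-normal if every sequence in $\mathcal{F}$ has a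 subsequence converging uniformly on compact subsets to a holomorphic map $X\to\widehat{\mathbb{C}}\times\widehat{\mathbb{C}}$ (with $\widehat{\mathbb{C}}$ the Riemann sphere). For a holomorphic map $F\colon\mathbb{C}^2\to\mathbb{C}^2$ and any of these notions, the Fatou set of $F$ is the set of points having an open neighborhood on which the family of iterates $(F^n)_{n\in\mathbb{N}}$ is normal; the Julia set is its complement in $\mathbb{C}^2$. When no notion is specified, statements are meant for all three. *)

theory Defs
  imports "HOL-Analysis.Analysis"
begin

section \<open>Complex projective space\<close>

text \<open>
  The space \<open>'n cproj\<close> of complex lines in \<open>complex^'n\<close> is \<open>P\<^sub>m\<close> with \<open>m = CARD('n) - 1\<close>:
  \<open>3 cproj\<close> is the projective plane and \<open>2 cproj\<close> is the Riemann sphere.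
\<close>

definition proj_rel :: "complex^'n \<Rightarrow> complex^'n \<Rightarrow> bool" where
  "proj_rel u v \<longleftrightarrow> u \<noteq> 0 \<and> v \<noteq> 0 \<and> (\<exists>c. u = c *s v)"

lemma proj_rel_self [simp]: "proj_rel v v \<longleftrightarrow> v \<noteq> 0"
  unfolding proj_rel_def by (auto intro: exI[of _ 1])

lemma proj_relE:
  assumes "proj_rel u v"
  obtains c where "c \<noteq> 0" "u = c *s v" "u \<noteq> 0" "v \<noteq> 0"
  using assms unfolding proj_rel_def by auto

lemma part_equivp_proj_rel: "part_equivp (proj_rel :: complex^'n \<Rightarrow> _)"
proof (rule part_equivpI)
  show "\<exists>v::complex^'n. proj_rel v v"
    by (rule exI[of _ "1 :: complex^'n"]) simp
  show "symp (proj_rel :: complex^'n \<Rightarrow> _)"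
  proof (rule sympI)
    fix u v :: "complex^'n" assume "proj_rel u v"
    then obtain c where c: "c \<noteq> 0" "u = c *s v" "u \<noteq> 0" "v \<noteq> 0" by (rule proj_relE)
    then have "v = inverse c *s u" by (simp add: vec_eq_iff)
    with c show "proj_rel v u" unfolding proj_rel_def by blast
  qed
  show "transp (proj_rel :: complex^'n \<Rightarrow> _)"
  proof (rule transpI)
    fix u v w :: "complex^'n" assume "proj_rel u v" "proj_rel v w"
    then show "proj_rel u w"
      unfolding proj_rel_def by (metis vector_smult_assoc)
  qed
qed

quotient_type 'n cproj = "complex^'n" / partial: proj_rel
  by (rule part_equivp_proj_rel)

lemma norm_smult_complex: "norm (c *s v) = cmod c * norm (v :: complex^'n)"
  by (simp add: norm_vec_def norm_mult L2_set_right_distrib)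

text \<open>The matrix of the orthogonal projection of \<open>complex^'n\<close> onto a line.\<close>

lift_definition line_projection :: "'n::finite cproj \<Rightarrow> complex^'n^'n"
  is "\<lambda>v. \<chi> i j. v $ i * cnj (v $ j) / of_real ((norm v)\<^sup>2)"
proof -
  fix u v :: "complex^'n" assume "proj_rel u v"
  then obtain c where c: "c \<noteq> 0" "u = c *s v" "u \<noteq> 0" "v \<noteq> 0" by (rule proj_relE)
  have "c * cnj c = of_real ((cmod c)\<^sup>2)" by (rule complex_norm_square[symmetric])
  moreover have "complex_of_real ((cmod c)\<^sup>2) \<noteq> 0" using c by simp
  ultimately show "(\<chi> i j. u $ i * cnj (u $ j) / of_real ((norm u)\<^sup>2)) =
      (\<chi> i j. v $ i * cnj (v $ j) / of_real ((norm v)\<^sup>2))"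
    unfolding c(2) norm_smult_complex power_mult_distrib of_real_mult
    by (simp add: vec_eq_iff) (simp add: divide_simps ac_simps)
qed

lemma sum_cnj_self: "(\<Sum>j\<in>UNIV. cnj (v $ j) * v $ j) = of_real ((norm (v :: complex^'n))\<^sup>2)"
proof -
  have "(norm v)\<^sup>2 = (\<Sum>j\<in>UNIV. (cmod (v $ j))\<^sup>2)"
    by (simp add: norm_vec_def L2_set_def sum_nonneg)
  then show ?thesis
    by (simp add: complex_norm_square mult.commute del: of_real_power)
qed

lemma line_projection_inject: "line_projection L = line_projection M \<Longrightarrow> L = M"
proof transfer
  fix u v :: "complex^'n"
  assume nz: "proj_rel u u" "proj_rel v v"
  assume eq: "(\<chi> i j. u $ i * cnj (u $ j) / of_real ((norm u)\<^sup>2)) =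
      (\<chi> i j. v $ i * cnj (v $ j) / of_real ((norm v)\<^sup>2))"
  have "u $ i = (\<Sum>j\<in>UNIV. cnj (v $ j) * u $ j / of_real ((norm v)\<^sup>2)) * v $ i" for i
  proof -
    have "u $ i = (\<Sum>j\<in>UNIV. cnj (u $ j) * u $ j) * u $ i / of_real ((norm u)\<^sup>2)"
      using nz by (simp add: sum_cnj_self)
    also have "\<dots> = (\<Sum>j\<in>UNIV. (u $ i * cnj (u $ j) / of_real ((norm u)\<^sup>2)) * u $ j)"
      by (simp add: sum_distrib_left sum_divide_distrib mult_ac)
    also have "\<dots> = (\<Sum>j\<in>UNIV. (v $ i * cnj (v $ j) / of_real ((norm v)\<^sup>2)) * u $ j)"
      using eq by (simp add: vec_eq_iff)
    also have "\<dots> = (\<Sum>j\<in>UNIV. cnj (v $ j) * u $ j / of_real ((norm v)\<^sup>2)) * v $ i"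
      by (simp add: sum_distrib_left mult_ac)
    finally show ?thesis .
  qed
  then have "u = (\<Sum>j\<in>UNIV. cnj (v $ j) * u $ j / of_real ((norm v)\<^sup>2)) *s v"
    unfolding vec_eq_iff vector_smult_component by blast
  with nz show "proj_rel u v" unfolding proj_rel_def by auto
qed

text \<open>
  The distance of two lines is the Frobenius distance of their projections, that is \<open>sqrt 2 * sin \<theta>\<close>
  for the angle \<open>\<theta>\<close> between the lines. It induces the quotient topology (\<open>open_cproj_iff\<close> below);
  projective space being compact, uniform convergence does not depend on the choice of the metric.
\<close>

instantiation cproj :: (finite) metric_space
begin

definition dist_cproj :: "'a cproj \<Rightarrow> 'a cproj \<Rightarrow> real" where
  "dist_cproj L M = dist (line_projection L) (line_projection M)"

definition uniformity_cproj :: "('a cproj \<times> 'a cproj) filter" where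
  "uniformity_cproj = (INF e\<in>{0<..}. principal {(x, y). dist x y < e})"

definition open_cproj :: "'a cproj set \<Rightarrow> bool" where
  "open_cproj U \<longleftrightarrow> (\<forall>x\<in>U. \<forall>\<^sub>F (x', y) in uniformity. x' = x \<longrightarrow> y \<in> U)"

instance
proof
  fix x y z :: "'a cproj"
  show "dist x y = 0 \<longleftrightarrow> x = y"
    using line_projection_inject by (auto simp: dist_cproj_def)
  show "dist x y \<le> dist x z + dist y z"
    unfolding dist_cproj_def by (rule dist_triangle2)
qed (simp_all add: uniformity_cproj_def open_cproj_def)

end

lemma open_cproj_iff:
  "open (U :: 'n::finite cproj set) \<longleftrightarrow> open {v. v \<noteq> 0 \<and> abs_cproj v \<in> U}"
proof
  have lp: "line_projection (abs_cproj v) =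
      (\<chi> i j. v $ i * cnj (v $ j) / of_real ((norm v)\<^sup>2))" if "v \<noteq> 0" for v :: "complex^'n"
    using that by (simp add: line_projection.abs_eq)
  have cont: "continuous_on {v. v \<noteq> 0} (\<lambda>v::complex^'n. line_projection (abs_cproj v))"
    by (subst continuous_on_cong[OF refl lp]) (auto intro!: continuous_intros)
  {
    assume U: "open U"
    have "continuous_on {v. v \<noteq> 0} (abs_cproj :: complex^'n \<Rightarrow> _)"
      using cont unfolding continuous_on_iff dist_cproj_def .
    moreover have "open {v :: complex^'n. v \<noteq> 0}"
      by (simp add: open_Collect_neq)
    ultimately have "open ({v. v \<noteq> 0} \<inter> abs_cproj -` U)"
      using U continuous_on_open_vimage by (metis Int_commute)
    then show "open {v. v \<noteq> 0 \<and> abs_cproj v \<in> U}"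
      by (simp add: Int_def vimage_def)
  }
  {
    assume op: "open {v :: complex^'n. v \<noteq> 0 \<and> abs_cproj v \<in> U}"
    show "open U"
      unfolding open_dist
    proof
      fix L assume "L \<in> U"
      obtain u where u: "u \<noteq> 0" "L = abs_cproj u"
        using Quotient_cproj by (metis Quotient_def proj_rel_self)
      let ?act = "\<lambda>M. line_projection M *v u"
      have fix_u: "?act L = u"
      proof -
        have "(\<Sum>j\<in>UNIV. (u $ i * cnj (u $ j) / of_real ((norm u)\<^sup>2)) * u $ j) =
            u $ i * (\<Sum>j\<in>UNIV. cnj (u $ j) * u $ j) / of_real ((norm u)\<^sup>2)" for i
          by (simp add: sum_distrib_left sum_divide_distrib mult_ac)
        then show ?thesis
          using u by (simp add: vec_eq_iff matrix_vector_mult_def lp sum_cnj_self)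
      qed
      obtain e where e: "e > 0" "\<And>v. dist v u < e \<Longrightarrow> v \<noteq> 0 \<and> abs_cproj v \<in> U"
        using op u \<open>L \<in> U\<close> unfolding open_dist by blast
      have "((\<lambda>A. A *v u) \<longlongrightarrow> line_projection L *v u) (at (line_projection L))"
        unfolding matrix_vector_mult_def by (intro tendsto_intros)
      then obtain d where d: "d > 0"
        "\<And>A. dist A (line_projection L) < d \<Longrightarrow> dist (A *v u) (line_projection L *v u) < e"
        using e(1) unfolding Lim_at by (metis dist_self zero_less_dist_iff)
      have "M \<in> U" if "dist M L < d" for M
      proof -
        obtain v where v: "v \<noteq> 0" "M = abs_cproj v"
          using Quotient_cproj by (metis Quotient_def proj_rel_self)
        have "dist (?act M) u < e"
          using d(2) that fix_u unfolding dist_cproj_def by metis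
        then have in_U: "?act M \<noteq> 0" "abs_cproj (?act M) \<in> U" using e(2) by auto
        have "?act M = (\<Sum>j\<in>UNIV. cnj (v $ j) * u $ j / of_real ((norm v)\<^sup>2)) *s v"
          using v by (simp add: vec_eq_iff matrix_vector_mult_def lp sum_distrib_left mult_ac)
        then have "proj_rel (?act M) v"
          using in_U v unfolding proj_rel_def by blast
        then have "abs_cproj (?act M) = M"
          using v Quotient_rel_abs[OF Quotient_cproj] by metis
        with in_U show ?thesis by simp
      qed
      then show "\<exists>d>0. \<forall>M. dist M L < d \<longrightarrow> M \<in> U" using d(1) by blast
    qed
  }
qed


text \<open>
  The affine charts: \<open>affine_domain i\<close> is the open set of lines on which the homogeneous coordinate
  \<open>v $ i\<close> is nonzero, and the functions \<open>affine_coord i j\<close> with \<open>j \<noteq> i\<close> are the coordinates on it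
  (\<open>affine_coord i i\<close> is constantly 1 there).
\<close>

lift_definition affine_coord :: "'n::finite \<Rightarrow> 'n \<Rightarrow> 'n cproj \<Rightarrow> complex"
  is "\<lambda>i j v. v $ j / v $ i"
  by (auto elim!: proj_relE)

lift_definition in_affine_domain :: "'n::finite \<Rightarrow> 'n cproj \<Rightarrow> bool"
  is "\<lambda>i v. v $ i \<noteq> 0"
  by (auto elim!: proj_relE)

definition affine_domain :: "'n::finite \<Rightarrow> 'n cproj set" where
  "affine_domain i = {L. in_affine_domain i L}"

lemma open_affine_domain: "open (affine_domain i)"
proof -
  have "{v. v \<noteq> 0 \<and> abs_cproj v \<in> affine_domain i} = {v. v $ i \<noteq> 0}"
  proof (intro Collect_cong)
    fix v :: "complex^'a"
    have "v $ i \<noteq> 0 \<Longrightarrow> v \<noteq> 0" by auto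
    then show "v \<noteq> 0 \<and> abs_cproj v \<in> affine_domain i \<longleftrightarrow> v $ i \<noteq> 0"
      using in_affine_domain.abs_eq[of v i] unfolding affine_domain_def mem_Collect_eq proj_rel_self
      by blast
  qed
  moreover have "open {v :: complex^'a. v $ i \<noteq> 0}"
    by (intro open_Collect_neq continuous_intros)
  ultimately show ?thesis by (simp add: open_cproj_iff)
qed

text \<open>The inclusions \<open>z \<mapsto> [z : 1]\<close> and \<open>(z, w) \<mapsto> [z : w : 1]\<close>.\<close>

lift_definition to_sphere :: "complex \<Rightarrow> 2 cproj"
  is "\<lambda>z. vector [z, 1]"
  by (auto simp: vec_eq_iff forall_2)

lift_definition to_plane :: "complex \<times> complex \<Rightarrow> 3 cproj"
  is "\<lambda>p. vector [fst p, snd p, 1]"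
  by (auto simp: vec_eq_iff forall_3)

definition to_spheres :: "complex \<times> complex \<Rightarrow> 2 cproj \<times> 2 cproj" where
  "to_spheres p = (to_sphere (fst p), to_sphere (snd p))"


section \<open>Holomorphic maps on open subsets of \<open>complex \<times> complex\<close>\<close>

definition hol_fun_on :: "(complex \<times> complex \<Rightarrow> complex) \<Rightarrow> (complex \<times> complex) set \<Rightarrow> bool" where
  "hol_fun_on \<phi> X \<longleftrightarrow>
    (\<forall>p\<in>X. \<exists>a b. (\<phi> has_derivative (\<lambda>v. a * fst v + b * snd v)) (at p within X))"

definition hol_plane_on ::
  "(complex \<times> complex \<Rightarrow> complex \<times> complex) \<Rightarrow> (complex \<times> complex) set \<Rightarrow> bool" where
  "hol_plane_on \<phi> X \<longleftrightarrow> hol_fun_on (\<lambda>p. fst (\<phi> p)) X \<and> hol_fun_on (\<lambda>p. snd (\<phi> p)) X"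

definition hol_cproj_on ::
  "(complex \<times> complex \<Rightarrow> 'n::finite cproj) \<Rightarrow> (complex \<times> complex) set \<Rightarrow> bool" where
  "hol_cproj_on \<phi> X \<longleftrightarrow> continuous_on X \<phi> \<and>
    (\<forall>i j. hol_fun_on (\<lambda>p. affine_coord i j (\<phi> p)) {p \<in> X. \<phi> p \<in> affine_domain i})"

definition hol_spheres_on ::
  "(complex \<times> complex \<Rightarrow> 2 cproj \<times> 2 cproj) \<Rightarrow> (complex \<times> complex) set \<Rightarrow> bool" where
  "hol_spheres_on \<phi> X \<longleftrightarrow> hol_cproj_on (\<lambda>p. fst (\<phi> p)) X \<and> hol_cproj_on (\<lambda>p. snd (\<phi> p)) X"


section \<open>Normal families, Fatou and Julia sets\<close>

definition converges_compactly ::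
  "'a::topological_space set \<Rightarrow> (nat \<Rightarrow> 'a \<Rightarrow> 'b::metric_space) \<Rightarrow> ('a \<Rightarrow> 'b) \<Rightarrow> bool" where
  "converges_compactly X s l \<longleftrightarrow>
    (\<forall>K. compact K \<and> K \<subseteq> X \<longrightarrow> uniform_limit K s l sequentially)"

definition diverges_compactly ::
  "'a::topological_space set \<Rightarrow> (nat \<Rightarrow> 'a \<Rightarrow> 'b::real_normed_vector) \<Rightarrow> bool" where
  "diverges_compactly X s \<longleftrightarrow>
    (\<forall>K. compact K \<and> K \<subseteq> X \<longrightarrow> (\<forall>R. \<forall>\<^sub>F n in sequentially. \<forall>p\<in>K. R < norm (s n p)))"

text \<open>
  A family on an open set \<open>X\<close> is given as a set of total functions; only their restrictions to \<open>X\<close>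
  matter.
\<close>

type_synonym normality =
  "(complex \<times> complex) set \<Rightarrow> (complex \<times> complex \<Rightarrow> complex \<times> complex) set \<Rightarrow> bool"

definition normal_one_point :: normality where
  "normal_one_point X \<F> \<longleftrightarrow> (\<forall>s::nat \<Rightarrow> _. range s \<subseteq> \<F> \<longrightarrow>
    diverges_compactly X s \<or>
    (\<exists>r l. strict_mono (r :: nat \<Rightarrow> nat) \<and> hol_plane_on l X \<and>
      converges_compactly X (\<lambda>k. s (r k)) l))"

definition normal_projective :: normality where
  "normal_projective X \<F> \<longleftrightarrow> (\<forall>s::nat \<Rightarrow> _. range s \<subseteq> \<F> \<longrightarrow>
    (\<exists>r l. strict_mono (r :: nat \<Rightarrow> nat) \<and> hol_cproj_on l X \<and>
      converges_compactly X (\<lambda>k p. to_plane (s (r k) p)) l))"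

definition normal_spheres :: normality where
  "normal_spheres X \<F> \<longleftrightarrow> (\<forall>s::nat \<Rightarrow> _. range s \<subseteq> \<F> \<longrightarrow>
    (\<exists>r l. strict_mono (r :: nat \<Rightarrow> nat) \<and> hol_spheres_on l X \<and>
      converges_compactly X (\<lambda>k p. to_spheres (s (r k) p)) l))"

definition fatou_set ::
  "normality \<Rightarrow> (complex \<times> complex \<Rightarrow> complex \<times> complex) \<Rightarrow> (complex \<times> complex) set" where
  "fatou_set normal F = {p. \<exists>U. open U \<and> p \<in> U \<and> normal U (range (\<lambda>n. F ^^ n))}"

definition julia_set ::
  "normality \<Rightarrow> (complex \<times> complex \<Rightarrow> complex \<times> complex) \<Rightarrow> (complex \<times> complex) set" where
  "julia_set normal F = - fatou_set normal F"

definition skew_product ::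
  "(complex \<Rightarrow> complex) \<Rightarrow> (complex \<Rightarrow> complex) \<Rightarrow> (complex \<Rightarrow> complex) \<Rightarrow>
    complex \<times> complex \<Rightarrow> complex \<times> complex" where
  "skew_product f g h = (\<lambda>(z, w). (f z + w * h z, g w))"

end

theory Submission
  imports Defs "HOL-Complex_Analysis.Complex_Analysis"
begin

text \<open>
  Write \<open>z\<^sub>n = f\<^sup>n(z\<^sub>0)\<close>. The function \<open>h\<close> is a limit of entire functions. At each step one fixes
  a time \<open>m\<close> with \<open>z\<^sub>m\<close> and \<open>z\<^sub>m\<^sub>+\<^sub>1\<close> large and a small \<open>w \<noteq> 0\<close>, and adds to the current
  function one that is tiny on a large disc, vanishes at the finitely many points that matter so far,
  in particular at the first coordinates of the first \<open>m\<close> points of the orbit of \<open>(z\<^sub>0, w)\<close>, and has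
  at the next one the value that sends the first coordinate to \<open>0\<close> at time \<open>m + 1\<close>. In the limit
  there are points \<open>(z\<^sub>0, w)\<close> arbitrarily close to \<open>(z\<^sub>0, 0)\<close> and times at which the orbit of
  \<open>(z\<^sub>0, 0)\<close> is near infinity, while that of \<open>(z\<^sub>0, w)\<close> is in \<open>{0} \<times> cball 0 1\<close>.
\<close>

section \<open>Iterates of skew products\<close>

lemma snd_skew_product_funpow: "snd ((skew_product f g h ^^ n) p) = (g ^^ n) (snd p)"
  by (induction n) (auto simp: skew_product_def split: prod.split)

lemma fst_skew_product_funpow_Suc:
  "fst ((skew_product f g h ^^ Suc n) p) =
    f (fst ((skew_product f g h ^^ n) p)) + (g ^^ n) (snd p) * h (fst ((skew_product f g h ^^ n) p))"
  using snd_skew_product_funpow[of n f g h p]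
  by (auto simp: skew_product_def split: prod.split)

lemma skew_product_funpow_zero:
  assumes "g 0 = 0"
  shows "(skew_product f g h ^^ n) (z, 0) = ((f ^^ n) z, 0)"
  using assms by (induction n) (auto simp: skew_product_def)

text \<open>Allows \<open>h\<close> to be altered without disturbing a finite piece of an orbit,
  provided the change vanishes at the first coordinates visited before the last time.\<close>

lemma skew_product_funpow_cong:
  assumes "\<And>j. j < n \<Longrightarrow> h' (fst ((skew_product f g h ^^ j) p)) = h (fst ((skew_product f g h ^^ j) p))"
  shows "(skew_product f g h' ^^ n) p = (skew_product f g h ^^ n) p"
  using assms
proof (induction n)
  case (Suc n)
  then have "(skew_product f g h' ^^ n) p = (skew_product f g h ^^ n) p" by simp
  moreover have "skew_product f g h' q = skew_product f g h q" if "h' (fst q) = h (fst q)" for q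
    using that by (cases q) (simp add: skew_product_def)
  ultimately show ?case using Suc.prems[of n] by simp
qed simp

lemma continuous_fst_skew_product_funpow:
  assumes "continuous_on UNIV f" "continuous_on UNIV g" "continuous_on UNIV h"
  shows "continuous_on UNIV (\<lambda>w. fst ((skew_product f g h ^^ n) (z, w)))"
proof -
  have eq: "skew_product f g h = (\<lambda>p. (f (fst p) + snd p * h (fst p), g (snd p)))"
    by (auto simp: skew_product_def)
  have "continuous_on UNIV (skew_product f g h)"
    unfolding eq
    by (intro continuous_intros continuous_on_compose2[OF assms(1)]
        continuous_on_compose2[OF assms(2)] continuous_on_compose2[OF assms(3)]) auto
  then have "continuous_on UNIV (skew_product f g h ^^ n)"
    by (induction n) (auto simp: id_def intro: continuous_on_compose2)
  then have "continuous_on UNIV (\<lambda>w. (skew_product f g h ^^ n) (z, w))"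
    by (rule continuous_on_compose2) (auto intro!: continuous_intros)
  then show ?thesis by (rule continuous_on_fst)
qed

section \<open>One-variable ingredients: interpolation, orbits of \<open>f\<close>, the zero of
  \<open>g\<close>\<close>

text \<open>A Lagrange polynomial that vanishes on \<open>S\<close> and equals \<open>c\<close> at
  \<open>a\<close> is multiplied by \<open>(z / a) ^ N\<close>. This factor is 1 at
  \<open>a\<close>, and as \<open>R < norm a\<close> it is uniformly small on the disc for large
  \<open>N\<close>.\<close>

lemma entire_interpolation_small_on_disc:
  fixes a c :: complex
  assumes "finite S" "a \<notin> S" "0 \<le> R" "R < norm a" "0 < e"
  obtains q where "q holomorphic_on UNIV" "\<And>z. z \<in> S \<Longrightarrow> q z = 0" "q a = c"
    "\<And>z. norm z \<le> R \<Longrightarrow> norm (q z) \<le> e"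
proof -
  define p where "p z = c * (\<Prod>s\<in>S. (z - s)) / (\<Prod>s\<in>S. (a - s))" for z
  have hp: "p holomorphic_on UNIV"
    unfolding p_def using assms by (intro holomorphic_intros) auto
  have "bounded (p ` cball 0 R)"
    by (intro compact_imp_bounded compact_continuous_image compact_cball
        holomorphic_on_imp_continuous_on holomorphic_on_subset[OF hp]) auto
  then obtain M where M: "M > 0" "\<And>z. norm z \<le> R \<Longrightarrow> norm (p z) \<le> M"
    unfolding bounded_pos by auto
  have "(\<lambda>N. (R / norm a) ^ N * M) \<longlonglongrightarrow> 0 * M"
    using assms by (intro tendsto_intros LIMSEQ_power_zero) (auto simp: divide_simps)
  then have "\<forall>\<^sub>F N in sequentially. (R / norm a) ^ N * M < e"
    using assms order_tendstoD(2) by fastforce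
  then obtain N where N: "(R / norm a) ^ N * M < e"
    using eventually_sequentially by auto
  define q where "q z = (z / a) ^ N * p z" for z
  have a: "a \<noteq> 0" using assms by auto
  show thesis
  proof
    show "q holomorphic_on UNIV"
      unfolding q_def using a by (intro holomorphic_intros hp) auto
    show "q z = 0" if "z \<in> S" for z
      using that assms by (auto simp: q_def p_def)
    show "q a = c"
      using a assms by (auto simp: q_def p_def)
    show "norm (q z) \<le> e" if "norm z \<le> R" for z
    proof -
      have "norm (q z) = (norm z / norm a) ^ N * norm (p z)"
        by (simp add: q_def norm_mult norm_power norm_divide)
      also have "\<dots> \<le> (R / norm a) ^ N * M"
        using that M assms by (intro mult_mono power_mono divide_right_mono) auto
      finally show ?thesis using N by simp
    qed
  qed
qed

text \<open>A repetition would make the orbit eventually periodic, so finite and bounded.\<close>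

lemma inj_orbit_if_unbounded:
  fixes f :: "'a::real_normed_vector \<Rightarrow> 'a"
  assumes "\<And>B. \<exists>n. B < norm ((f ^^ n) z)"
  shows "inj (\<lambda>n. (f ^^ n) z)"
proof (rule linorder_injI)
  fix i j :: nat assume ij: "i < j"
  show "(f ^^ i) z \<noteq> (f ^^ j) z"
  proof
    assume eq: "(f ^^ i) z = (f ^^ j) z"
    have "(f ^^ k) z \<in> (\<lambda>n. (f ^^ n) z) ` {..j}" for k
    proof (induction k rule: less_induct)
      case (less k)
      show ?case
      proof (cases "k \<le> j")
        case False
        \<comment> \<open>The points at times \<open>i\<close> and \<open>j\<close> coincide, so a
          time beyond \<open>j\<close> can be lowered by \<open>j - i > 0\<close>.\<close>
        then have "(f ^^ k) z = (f ^^ (k - j)) ((f ^^ j) z)"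
          by (metis comp_apply funpow_add le_add_diff_inverse2 nat_le_linear)
        also have "\<dots> = (f ^^ (k - j + i)) z"
          by (simp add: eq[symmetric] funpow_add)
        finally show ?thesis using less[of "k - j + i"] False ij by auto
      qed auto
    qed
    then have "bounded (range (\<lambda>k. (f ^^ k) z))"
      by (meson finite_atMost finite_imageI finite_imp_bounded bounded_subset image_subsetI)
    then show False
      using assms unfolding bounded_iff by (metis not_less rangeI)
  qed
qed

lemma filterlim_funpow_at:
  assumes "filterlim g (at a) (at a)"
  shows "filterlim (g ^^ n) (at a) (at a)"
  by (induction n) (auto simp: filterlim_ident id_def o_def intro: filterlim_compose[OF assms])

text \<open>The zero of \<open>g\<close> at 0 is isolated. Hence for small
  \<open>w \<noteq> 0\<close> the factor \<open>(g ^^ m) w\<close> in front of \<open>h\<close> does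
  not vanish, and the value of \<open>h\<close> can steer the first coordinate.\<close>

lemma filterlim_at_zero_if_entire:
  assumes "g holomorphic_on UNIV" "\<not> g constant_on UNIV" "g 0 = 0"
  shows "filterlim g (at 0) (at 0)"
proof -
  obtain e where "0 < e" "\<And>w. w \<in> ball 0 e - {0} \<Longrightarrow> g w \<noteq> 0"
    using isolated_zeros[OF assms(1) open_UNIV connected_UNIV _ assms(3)] assms(2,3)
    unfolding constant_on_def by (metis UNIV_I Diff_iff insertCI)
  then have "\<forall>\<^sub>F w in at 0. g w \<noteq> 0"
    unfolding eventually_at by (intro exI[of _ e]) (auto simp: dist_commute)
  moreover have "(g \<longlongrightarrow> g 0) (at 0)"
    using holomorphic_on_imp_continuous_on[OF assms(1)]
    by (simp add: continuous_on_eq_continuous_at isCont_def)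
  ultimately show ?thesis
    using assms(3) by (simp add: filterlim_at)
qed

text \<open>Size at time \<open>m\<close> leaves room for changing \<open>h\<close> off a large
  disc; size at time \<open>Suc m\<close> keeps the unperturbed orbit near infinity when the
  perturbed one returns.\<close>

lemma consecutive_large_orbit_points:
  fixes f :: "complex \<Rightarrow> complex"
  assumes "continuous_on UNIV f" "\<And>B. \<exists>n. B < norm ((f ^^ n) z)"
  shows "\<exists>m. B < norm ((f ^^ m) z) \<and> B < norm ((f ^^ Suc m) z)"
proof -
  have "bounded (f ` cball 0 B)"
    by (intro compact_imp_bounded compact_continuous_image compact_cball
        continuous_on_subset[OF assms(1)]) auto
  then obtain M where M: "\<And>x. norm x \<le> B \<Longrightarrow> norm (f x) \<le> M"
    unfolding bounded_iff by (metis imageI mem_cball_0)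
  \<comment> \<open>Exceeding \<open>norm z\<close> excludes time 0, and exceeding \<open>M\<close>
    forces the preceding point out of \<open>cball 0 B\<close>.\<close>
  obtain n where n: "max (norm z) (max B M) < norm ((f ^^ n) z)"
    using assms(2) by blast
  then obtain m where m: "n = Suc m"
    by (cases n) auto
  then show ?thesis
    using n M[of "(f ^^ m) z"] by (intro exI[of _ m]) fastforce
qed

section \<open>Inductive construction of \<open>h\<close>\<close>

text \<open>On \<open>S\<close> the values of \<open>H\<close> are frozen, which protects the
  returning orbits already built. \<open>S'\<close> also freezes the values that produce the new
  one.\<close>

lemma perturbation_step:
  assumes hol: "f holomorphic_on UNIV" "g holomorphic_on UNIV" "H holomorphic_on UNIV"
    and g: "\<not> g constant_on UNIV" "g 0 = 0"
    and unbounded: "\<And>B. \<exists>n. B < norm ((f ^^ n) z0)"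
    and "finite S" "0 < e"
  shows "\<exists>H' S' w n. H' holomorphic_on UNIV \<and> finite S' \<and> S \<subseteq> S' \<and>
    (\<forall>z\<in>S. H' z = H z) \<and> (\<forall>z. norm z \<le> R \<longrightarrow> norm (H' z - H z) \<le> e) \<and>
    norm w < e \<and> R < norm ((f ^^ n) z0) \<and> norm ((g ^^ n) w) \<le> 1 \<and>
    (\<forall>j<n. fst ((skew_product f g H' ^^ j) (z0, w)) \<in> S') \<and>
    fst ((skew_product f g H' ^^ n) (z0, w)) = 0"
proof -
  have "bounded S" using \<open>finite S\<close> by (rule finite_imp_bounded)
  then obtain B where B: "\<And>z. z \<in> S \<Longrightarrow> norm z \<le> B" unfolding bounded_iff by auto
  \<comment> \<open>The bound \<open>B\<close> keeps points of norm above \<open>r\<close> off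
    \<open>S\<close>, \<open>R\<close> is the radius required in the conclusion, and 0 makes
    \<open>r\<close> a legitimate radius for the interpolation.\<close>
  define r where "r = max 0 (max R B)"
  obtain m where m: "r < norm ((f ^^ m) z0)" "r < norm ((f ^^ Suc m) z0)"
    using consecutive_large_orbit_points[OF holomorphic_on_imp_continuous_on[OF hol(1)] unbounded]
    by blast
  define P where "P j w = fst ((skew_product f g H ^^ j) (z0, w))" for j w
  have P0: "P j 0 = (f ^^ j) z0" for j
    using g(2) by (simp add: P_def skew_product_funpow_zero)
  have P: "(P j \<longlongrightarrow> (f ^^ j) z0) (at 0)" for j
  proof -
    have "continuous_on UNIV (P j)"
      unfolding P_def
      by (intro continuous_fst_skew_product_funpow holomorphic_on_imp_continuous_on hol)
    then have "(P j \<longlongrightarrow> P j 0) (at 0)"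
      by (simp add: continuous_on_eq_continuous_at isCont_def)
    then show ?thesis by (simp add: P0)
  qed
  have g_at: "filterlim (g ^^ n) (at 0) (at 0)" for n
    by (rule filterlim_funpow_at[OF filterlim_at_zero_if_entire[OF hol(2) g]])
  have ev1: "\<forall>\<^sub>F w in at 0. r < norm (P m w)"
    by (rule order_tendstoD(1)[OF tendsto_norm[OF P] m(1)])
  \<comment> \<open>As \<open>w\<close> tends to 0 these points tend to points of the orbit of
    \<open>z0\<close> under \<open>f\<close>, which are pairwise distinct.\<close>
  have ev2: "\<forall>\<^sub>F w in at 0. \<forall>j\<in>{..<m}. P j w \<noteq> P m w"
  proof (rule eventually_ball_finite)
    show "\<forall>j\<in>{..<m}. \<forall>\<^sub>F w in at 0. P j w \<noteq> P m w"
    proof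
      fix j assume "j \<in> {..<m}"
      then have "(f ^^ j) z0 - (f ^^ m) z0 \<noteq> 0"
        using inj_orbit_if_unbounded[OF unbounded] by (auto dest: injD)
      then have "\<forall>\<^sub>F w in at 0. P j w - P m w \<noteq> 0"
        by (rule tendsto_imp_eventually_ne[OF tendsto_diff[OF P P]])
      then show "\<forall>\<^sub>F w in at 0. P j w \<noteq> P m w"
        by eventually_elim simp
    qed
  qed simp
  have ev3: "\<forall>\<^sub>F w in at 0. (g ^^ m) w \<noteq> 0"
    using g_at[of m] by (simp add: filterlim_at)
  have "((g ^^ Suc m) \<longlongrightarrow> 0) (at 0)"
    using g_at[of "Suc m"] unfolding filterlim_at by blast
  then have ev4: "\<forall>\<^sub>F w in at 0. norm ((g ^^ Suc m) w) < 1"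
    using order_tendstoD(2)[OF tendsto_norm] by fastforce
  have ev5: "\<forall>\<^sub>F w::complex in at 0. norm w < e"
    using \<open>0 < e\<close> unfolding eventually_at by auto
  have "\<forall>\<^sub>F w in at 0. r < norm (P m w) \<and> (\<forall>j\<in>{..<m}. P j w \<noteq> P m w) \<and> (g ^^ m) w \<noteq> 0 \<and>
      norm ((g ^^ Suc m) w) < 1 \<and> norm w < e"
    by (intro eventually_conj ev1 ev2 ev3 ev4 ev5)
  then obtain w where w: "r < norm (P m w)" "\<And>j. j < m \<Longrightarrow> P j w \<noteq> P m w" "(g ^^ m) w \<noteq> 0"
      "norm ((g ^^ Suc m) w) < 1" "norm w < e"
    using eventually_happens[of _ "at (0::complex)"] trivial_limit_at by blast
  define T where "T = S \<union> (\<lambda>j. P j w) ` {..<m}"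
  have "finite T" using \<open>finite S\<close> by (simp add: T_def)
  moreover have "P m w \<notin> T"
    using w(1,2) B[of "P m w"] by (force simp: T_def r_def)
  moreover have "0 \<le> r" by (simp add: r_def)
  \<comment> \<open>The value at \<open>P m w\<close> is the solution of
    \<open>f (P m w) + (g ^^ m) w * (H + q) (P m w) = 0\<close>.\<close>
  ultimately obtain q where q: "q holomorphic_on UNIV" "\<And>z. z \<in> T \<Longrightarrow> q z = 0"
      "q (P m w) = - (f (P m w) / (g ^^ m) w) - H (P m w)"
      "\<And>z. norm z \<le> r \<Longrightarrow> norm (q z) \<le> e"
    using entire_interpolation_small_on_disc w(1) \<open>0 < e\<close> by blast
  define H' where "H' z = H z + q z" for z
  have T: "H' z = H z" if "z \<in> T" for z
    using q(2)[OF that] by (simp add: H'_def)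
  \<comment> \<open>\<open>q\<close> vanishes at \<open>P j w\<close> for \<open>j < m\<close>, so
    the change first acts on the passage from time \<open>m\<close> to \<open>Suc m\<close>.\<close>
  have orbit: "(skew_product f g H' ^^ j) (z0, w) = (skew_product f g H ^^ j) (z0, w)"
    if "j \<le> m" for j
    by (rule skew_product_funpow_cong, rule T) (use that in \<open>auto simp: T_def P_def\<close>)
  have "fst ((skew_product f g H' ^^ Suc m) (z0, w)) =
      f (P m w) + (g ^^ m) w * H' (P m w)"
    unfolding fst_skew_product_funpow_Suc by (simp add: orbit P_def)
  also have "\<dots> = 0"
    using w(3) by (simp add: H'_def q(3) field_simps)
  finally have zero: "fst ((skew_product f g H' ^^ Suc m) (z0, w)) = 0" .
  have in_T: "fst ((skew_product f g H' ^^ j) (z0, w)) \<in> insert (P m w) T" if "j < Suc m" for j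
    using that orbit[of j] by (auto simp: T_def P_def less_Suc_eq)
  have "H' holomorphic_on UNIV"
    unfolding H'_def by (intro holomorphic_intros hol q)
  moreover have "norm (H' z - H z) \<le> e" if "norm z \<le> R" for z
    using q(4)[of z] that by (simp add: H'_def r_def)
  ultimately show ?thesis
    using \<open>finite T\<close> T zero in_T w(4,5) m(2)
    by (intro exI[of _ H'] exI[of _ "insert (P m w) T"] exI[of _ w] exI[of _ "Suc m"])
      (auto simp: T_def r_def)
qed

text \<open>The increments telescope, and on \<open>cball 0 r\<close> they are dominated by a
  geometric series from any index above \<open>r\<close> on, so the limit is locally
  uniform.\<close>

lemma entire_limit:
  assumes "\<And>k. H k holomorphic_on UNIV"
    and "\<And>k z. norm z \<le> real k \<Longrightarrow> norm (H (Suc k) z - H k z) \<le> (1/2) ^ k"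
  obtains h where "h holomorphic_on UNIV" "\<And>z. (\<lambda>k. H k z) \<longlonglongrightarrow> h z"
proof -
  define h where "h z = (\<Sum>k. H (Suc k) z - H k z) + H 0 z" for z
  have lim: "uniform_limit (cball 0 r) H h sequentially" for r
  proof -
    have "uniform_limit (cball 0 r) (\<lambda>n z. \<Sum>k<n. H (Suc k) z - H k z)
        (\<lambda>z. \<Sum>k. H (Suc k) z - H k z) sequentially"
    proof (rule Weierstrass_m_test_ev)
      obtain k0 :: nat where k0: "r \<le> real k0" using real_arch_simple by blast
      show "\<forall>\<^sub>F k in sequentially. \<forall>z\<in>cball 0 r. norm (H (Suc k) z - H k z) \<le> (1/2) ^ k"
        using eventually_ge_at_top[of k0]
        by eventually_elim (use k0 in \<open>auto intro!: assms(2)\<close>)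
    qed (simp add: summable_geometric)
    then have "uniform_limit (cball 0 r) (\<lambda>n z. (\<Sum>k<n. H (Suc k) z - H k z) + H 0 z) h sequentially"
      unfolding h_def by (intro uniform_limit_intros)
    moreover have "(\<Sum>k<n. H (Suc k) z - H k z) + H 0 z = H n z" for n z
      using sum_lessThan_telescope[of "\<lambda>k. H k z"] by simp
    ultimately show ?thesis by simp
  qed
  show thesis
  proof
    show "h holomorphic_on UNIV"
    proof (rule holomorphic_uniform_sequence[of UNIV H])
      fix z :: complex
      have "uniform_limit (cball z 1) H h sequentially"
        by (rule uniform_limit_on_subset[OF lim[of "norm z + 1"]])
          (simp add: cball_subset_cball_iff)
      then show "\<exists>d>0. cball z d \<subseteq> UNIV \<and> uniform_limit (cball z d) H h sequentially"
        by (intro exI[of _ 1]) auto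
    qed (use assms in auto)
    show "(\<lambda>k. H k z) \<longlonglongrightarrow> h z" for z
      by (rule tendsto_uniform_limitI[OF lim[of "norm z"]]) simp
  qed
qed

text \<open>The perturbation is iterated with radius \<open>k\<close> and tolerance
  \<open>(1/2) ^ k\<close> at stage \<open>k\<close>. Freezing makes every returning orbit survive
  in the limit.\<close>

lemma skew_product_with_returning_orbits:
  assumes hol: "f holomorphic_on UNIV" "g holomorphic_on UNIV"
    and g: "\<not> g constant_on UNIV" "g 0 = 0"
    and unbounded: "\<And>B. \<exists>n. B < norm ((f ^^ n) z0)"
  obtains h w n where "h holomorphic_on UNIV" "w \<longlonglongrightarrow> 0"
    "filterlim (\<lambda>k. (f ^^ n k) z0) at_infinity sequentially"
    "\<And>k. fst ((skew_product f g h ^^ n k) (z0, w k)) = 0"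
    "\<And>k. norm (snd ((skew_product f g h ^^ n k) (z0, w k))) \<le> 1"
proof -
  define step where "step k H S H' S' w n \<longleftrightarrow>
    S \<subseteq> S' \<and> (\<forall>z\<in>S. H' z = H z) \<and> (\<forall>z. norm z \<le> real k \<longrightarrow> norm (H' z - H z) \<le> (1/2) ^ k) \<and>
    norm w < (1/2) ^ k \<and> real k < norm ((f ^^ n) z0) \<and> norm ((g ^^ n) w) \<le> 1 \<and>
    (\<forall>j<n. fst ((skew_product f g H' ^^ j) (z0, w)) \<in> S') \<and>
    fst ((skew_product f g H' ^^ n) (z0, w)) = 0" for k H S H' S' w n
  obtain X where X: "\<And>k. fst (X k) holomorphic_on UNIV \<and> finite (snd (X k))"
    "\<And>k. \<exists>w n. step k (fst (X k)) (snd (X k)) (fst (X (Suc k))) (snd (X (Suc k))) w n"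
  proof -
    have "\<exists>Y. (fst Y holomorphic_on UNIV \<and> finite (snd Y)) \<and>
        (\<exists>w n. step k (fst X) (snd X) (fst Y) (snd Y) w n)"
      if X: "fst X holomorphic_on UNIV \<and> finite (snd X)" for X k
    proof -
      have X': "fst X holomorphic_on UNIV" "finite (snd X)" "(0::real) < (1/2) ^ k"
        using X by auto
      obtain H' S' w n where "H' holomorphic_on UNIV" "finite S'" "step k (fst X) (snd X) H' S' w n"
        using perturbation_step[OF hol X'(1) g unbounded X'(2,3), of "real k"]
        unfolding step_def by (elim exE conjE) (simp only: simp_thms)
      then show ?thesis
        by (intro exI[of _ "(H', S')"]) auto
    qed
    \<comment> \<open>The recursion starts from a constant function and the empty set.\<close>
    then show thesis
      using that dependent_nat_choice[of "\<lambda>_ X. fst X holomorphic_on UNIV \<and> finite (snd X)"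
          "\<lambda>k X Y. \<exists>w n. step k (fst X) (snd X) (fst Y) (snd Y) w n"]
      by (metis finite.emptyI fst_conv holomorphic_on_const snd_conv)
  qed
  define H where "H k = fst (X k)" for k
  define S where "S k = snd (X k)" for k
  have hol_H: "H k holomorphic_on UNIV" for k
    using X(1)[of k] by (simp add: H_def)
  have "\<exists>w n. step k (H k) (S k) (H (Suc k)) (S (Suc k)) w n" for k
    using X(2)[of k] by (simp add: H_def S_def)
  then obtain w n where st: "\<And>k. step k (H k) (S k) (H (Suc k)) (S (Suc k)) (w k) (n k)"
    by metis
  obtain h where h: "h holomorphic_on UNIV" "\<And>z. (\<lambda>k. H k z) \<longlonglongrightarrow> h z"
    by (rule entire_limit[of H]) (use hol_H st in \<open>auto simp: step_def\<close>)
  have H_on_S: "H i z = H k z \<and> z \<in> S i" if "k \<le> i" "z \<in> S k" for i k z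
    using that(1)
  proof (induction i rule: dec_induct)
    case (step i)
    then show ?case using st[of i] unfolding step_def by auto
  qed (use that in auto)
  have h_on_S: "h z = H k z" if "z \<in> S k" for k z
  proof (rule LIMSEQ_unique[OF h(2)])
    have "\<forall>\<^sub>F i in sequentially. H k z = H i z"
      using eventually_ge_at_top[of k] by eventually_elim (use H_on_S that in metis)
    then show "(\<lambda>i. H i z) \<longlonglongrightarrow> H k z"
      by (rule Lim_transform_eventually[OF tendsto_const])
  qed
  \<comment> \<open>Before time \<open>n k\<close> this orbit only visits first coordinates in
    \<open>S (Suc k)\<close>, where \<open>h\<close> agrees with \<open>H (Suc k)\<close>.\<close>
  have orbit: "(skew_product f g h ^^ n k) (z0, w k) =
      (skew_product f g (H (Suc k)) ^^ n k) (z0, w k)" for k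
    by (rule skew_product_funpow_cong, rule h_on_S) (use st[of k] in \<open>auto simp: step_def\<close>)
  show thesis
  proof
    show "h holomorphic_on UNIV" by (rule h(1))
    have bound: "norm (w k) \<le> (1/2) ^ k" for k
      using st[of k] by (simp add: step_def)
    show "w \<longlonglongrightarrow> 0"
      by (rule Lim_null_comparison[OF always_eventually[OF allI[OF bound]]])
        (simp add: LIMSEQ_power_zero)
    have "filterlim (\<lambda>k. norm ((f ^^ n k) z0)) at_top sequentially"
      by (rule filterlim_at_top_mono[OF filterlim_real_sequentially])
        (use st in \<open>auto simp: step_def less_imp_le\<close>)
    then show "filterlim (\<lambda>k. (f ^^ n k) z0) at_infinity sequentially"
      by (rule filterlim_norm_at_top_imp_at_infinity)
    show "fst ((skew_product f g h ^^ n k) (z0, w k)) = 0" for k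
      using st[of k] by (simp add: orbit step_def)
    show "norm (snd ((skew_product f g h ^^ n k) (z0, w k))) \<le> 1" for k
      using st[of k] by (simp add: snd_skew_product_funpow step_def)
  qed
qed

section \<open>Compact convergence along moving points, and distances in projective space\<close>

text \<open>The points \<open>p k\<close> eventually lie in a compact ball around \<open>a\<close>
  inside \<open>U\<close>; there uniform convergence and continuity of \<open>l\<close>
  combine.\<close>

lemma converges_compactly_tendsto:
  fixes l :: "'a::heine_borel \<Rightarrow> 'b::metric_space"
  assumes "converges_compactly U s l" "open U" "continuous_on U l" "p \<longlonglongrightarrow> a" "a \<in> U"
  shows "(\<lambda>k. s k (p k)) \<longlonglongrightarrow> l a"
proof -
  obtain e where e: "0 < e" "cball a e \<subseteq> U"
    using assms(2,5) open_contains_cball by blast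
  have p: "\<forall>\<^sub>F k in sequentially. p k \<in> cball a e"
    using tendstoD[OF assms(4) e(1)] by eventually_elim (simp add: dist_commute less_imp_le)
  have lim: "uniform_limit (cball a e) s l sequentially"
    using assms(1) e(2) compact_cball unfolding converges_compactly_def by metis
  have lp: "(\<lambda>k. l (p k)) \<longlonglongrightarrow> l a"
    using continuous_on_interior[OF assms(3), of a] assms(2,5)
    by (intro isCont_tendsto_compose[OF _ assms(4)]) (simp add: interior_open)
  have "(\<lambda>k. dist (s k (p k)) (l (p k))) \<longlonglongrightarrow> 0"
  proof (rule tendstoI)
    fix d :: real assume "0 < d"
    then have "\<forall>\<^sub>F k in sequentially. \<forall>x\<in>cball a e. dist (s k x) (l x) < d"
      using lim by (simp add: uniform_limit_iff)
    with p show "\<forall>\<^sub>F k in sequentially. dist (dist (s k (p k)) (l (p k))) 0 < d"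
      by eventually_elim simp
  qed
  moreover have "(\<lambda>k. dist (l (p k)) (l a)) \<longlonglongrightarrow> 0"
    using lp by (subst (asm) tendsto_dist_iff)
  ultimately have "(\<lambda>k. dist (s k (p k)) (l (p k)) + dist (l (p k)) (l a)) \<longlonglongrightarrow> 0"
    using tendsto_add by fastforce
  then have "(\<lambda>k. dist (s k (p k)) (l a)) \<longlonglongrightarrow> 0"
    by (rule tendsto_sandwich[OF _ _ tendsto_const, rotated 2]) (auto simp: dist_triangle)
  then show ?thesis by (subst tendsto_dist_iff)
qed

text \<open>The obstruction to normality: images of \<open>a\<close> and of points tending to
  \<open>a\<close> cannot stay apart.\<close>

lemma converges_compactly_dist_tendsto_zero:
  fixes l :: "'a::heine_borel \<Rightarrow> 'b::metric_space"
  assumes "converges_compactly U s l" "open U" "continuous_on U l" "p \<longlonglongrightarrow> a" "a \<in> U"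
  shows "(\<lambda>k. dist (s k a) (s k (p k))) \<longlonglongrightarrow> 0"
  using tendsto_dist[OF converges_compactly_tendsto[OF assms(1-3) tendsto_const assms(5)]
      converges_compactly_tendsto[OF assms]] by simp

lemma norm_matrix_entry_le: "norm ((A :: complex^'n^'m) $ i $ j) \<le> norm A"
  by (rule order_trans[OF Finite_Cartesian_Product.norm_nth_le Finite_Cartesian_Product.norm_nth_le])

text \<open>The left side is the diagonal entry at \<open>i\<close> of the projection onto
  \<open>u\<close>, while that of \<open>v\<close> is 0; an entry is bounded by the Frobenius
  norm.\<close>

lemma dist_cproj_ge:
  fixes u v :: "complex^'n"
  assumes "u \<noteq> 0" "v \<noteq> 0" "v $ i = 0"
  shows "(norm (u $ i))\<^sup>2 / (norm u)\<^sup>2 \<le> dist (abs_cproj u) (abs_cproj v)"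
proof -
  let ?A = "line_projection (abs_cproj u) - line_projection (abs_cproj v)"
  have "?A $ i $ i = of_real ((norm (u $ i))\<^sup>2 / (norm u)\<^sup>2)"
    using assms by (simp add: line_projection.abs_eq complex_norm_square del: of_real_power)
  then have "(norm (u $ i))\<^sup>2 / (norm u)\<^sup>2 = norm (?A $ i $ i)"
    by (simp add: norm_divide norm_power)
  then show ?thesis
    using norm_matrix_entry_le[of ?A i i] by (simp add: dist_cproj_def dist_norm)
qed

text \<open>The constant is the minimum of \<open>t / (t + 1)\<close> over \<open>t \<ge> 1\<close>,
  with \<open>t = (norm z)\<^sup>2\<close>.\<close>

lemma dist_to_sphere_zero:
  assumes "1 \<le> norm z"
  shows "1/2 \<le> dist (to_sphere z) (to_sphere 0)"
proof -
  let ?u = "vector [z, 1] :: complex^2" and ?v = "vector [0, 1] :: complex^2"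
  have "(norm ?u)\<^sup>2 = (norm z)\<^sup>2 + 1"
    by (simp add: norm_vec_def L2_set_def sum_2)
  moreover have "1 \<le> (norm z)\<^sup>2" using assms by simp
  ultimately have "1/2 \<le> (norm (?u $ 1))\<^sup>2 / (norm ?u)\<^sup>2"
    by (simp add: divide_simps)
  also have "\<dots> \<le> dist (abs_cproj ?u) (abs_cproj ?v)"
    by (rule dist_cproj_ge) (auto simp: vec_eq_iff forall_2)
  finally show ?thesis by (simp add: to_sphere.abs_eq)
qed

text \<open>The bound is uniform in \<open>w\<close> because it only compares first homogeneous
  coordinates, one of which is 0.\<close>

lemma dist_to_plane_zero:
  assumes "1 \<le> norm z"
  shows "1/2 \<le> dist (to_plane (z, 0)) (to_plane (0, w))"
proof -
  let ?u = "vector [z, 0, 1] :: complex^3" and ?v = "vector [0, w, 1] :: complex^3"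
  have "(norm ?u)\<^sup>2 = (norm z)\<^sup>2 + 1"
    by (simp add: norm_vec_def L2_set_def sum_3)
  moreover have "1 \<le> (norm z)\<^sup>2" using assms by simp
  ultimately have "1/2 \<le> (norm (?u $ 1))\<^sup>2 / (norm ?u)\<^sup>2"
    by (simp add: divide_simps)
  also have "\<dots> \<le> dist (abs_cproj ?u) (abs_cproj ?v)"
    by (rule dist_cproj_ge) (auto simp: vec_eq_iff forall_3)
  finally show ?thesis by (simp add: to_plane.abs_eq)
qed

section \<open>Failure of normality at \<open>(z0, 0)\<close>\<close>

theorem theorem1p1:
  fixes f g :: "complex \<Rightarrow> complex" and z0 :: complex and n :: "nat \<Rightarrow> nat"
  assumes "f holomorphic_on UNIV" and "\<not> f constant_on UNIV"
    and "g holomorphic_on UNIV" and "\<not> g constant_on UNIV" and "g 0 = 0"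
    and "strict_mono n"
    and "filterlim (\<lambda>k. (f ^^ n k) z0) at_infinity sequentially"
  shows "\<exists>h. h holomorphic_on UNIV \<and>
    (z0, 0) \<in> julia_set normal_one_point (skew_product f g h) \<and>
    (z0, 0) \<in> julia_set normal_projective (skew_product f g h) \<and>
    (z0, 0) \<in> julia_set normal_spheres (skew_product f g h)"
proof -
  have unbounded: "\<exists>i. B < norm ((f ^^ i) z0)" for B
  proof -
    have "\<forall>\<^sub>F k in sequentially. B < norm ((f ^^ n k) z0)"
      using filterlim_at_infinity_imp_norm_at_top[OF assms(7)] by (simp add: filterlim_at_top_dense)
    then show ?thesis using eventually_happens'[OF sequentially_bot] by blast
  qed
  obtain h w m where h: "h holomorphic_on UNIV" "w \<longlonglongrightarrow> 0"
    "filterlim (\<lambda>k. (f ^^ m k) z0) at_infinity sequentially"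
    "\<And>k. fst ((skew_product f g h ^^ m k) (z0, w k)) = 0"
    "\<And>k. norm (snd ((skew_product f g h ^^ m k) (z0, w k))) \<le> 1"
    by (rule skew_product_with_returning_orbits[OF assms(1,3,4,5) unbounded]) (rule that)
  define s where "s k = skew_product f g h ^^ m k" for k
  define p where "p k = (z0, w k)" for k
  have s_range: "range s \<subseteq> range (\<lambda>n. skew_product f g h ^^ n)"
    by (auto simp: s_def)
  have p: "p \<longlonglongrightarrow> (z0, 0)"
    unfolding p_def by (intro tendsto_intros h(2))
  have s_base: "s k (z0, 0) = ((f ^^ m k) z0, 0)" for k
    by (simp add: s_def skew_product_funpow_zero assms(5))
  have norm_top: "filterlim (\<lambda>k. norm ((f ^^ m k) z0)) at_top sequentially"
    by (rule filterlim_at_infinity_imp_norm_at_top[OF h(3)])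
  have s_p: "fst (s k (p k)) = 0" "norm (snd (s k (p k))) \<le> 1" for k
    using h(4,5)[of k] by (auto simp: s_def p_def)
  \<comment> \<open>Common to both compact targets, with \<open>T\<close> the embedding: along
    \<open>r\<close> the images of \<open>(z0, 0)\<close> and \<open>p (r k)\<close> would have to
    approach each other, but \<open>T\<close> keeps them at distance at least 1/2.\<close>
  have no_limit: False
    if l: "converges_compactly U (\<lambda>k x. T (s (r k) x)) l" "continuous_on U l"
      and U: "open U" "(z0, 0) \<in> U" and r: "strict_mono r"
      and T: "\<And>z w. 1 \<le> norm z \<Longrightarrow> 1/2 \<le> dist (T (z, 0)) (T (0, w))"
    for U r and T :: "complex \<times> complex \<Rightarrow> 'b::metric_space" and l
  proof -
    have "(\<lambda>k. dist (T (s (r k) (z0, 0))) (T (s (r k) (p (r k))))) \<longlonglongrightarrow> 0"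
      using converges_compactly_dist_tendsto_zero[OF l(1) U(1) l(2) LIMSEQ_subseq_LIMSEQ[OF p r] U(2)]
      by (simp add: o_def)
    then have "\<forall>\<^sub>F k in sequentially. dist (T (s (r k) (z0, 0))) (T (s (r k) (p (r k)))) < 1/2"
      by (rule order_tendstoD) simp
    moreover have "\<forall>\<^sub>F k in sequentially. 1 \<le> norm ((f ^^ m (r k)) z0)"
      using filterlim_compose[OF norm_top filterlim_subseq[OF r]] by (simp add: filterlim_at_top)
    ultimately have "\<forall>\<^sub>F k in sequentially. False"
    proof eventually_elim
      case (elim k)
      then show False
        using T[of "(f ^^ m (r k)) z0" "snd (s (r k) (p (r k)))"] s_p(1)[of "r k"]
        by (metis not_less prod.collapse s_base)
    qed
    then show False by simp
  qed
  have "\<not> normal_one_point U (range (\<lambda>n. skew_product f g h ^^ n))"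
    if U: "open U" "(z0, 0) \<in> U" for U
  proof
    assume "normal_one_point U (range (\<lambda>n. skew_product f g h ^^ n))"
    then consider "diverges_compactly U s"
      | r l where "strict_mono (r :: nat \<Rightarrow> nat)" "converges_compactly U (\<lambda>k. s (r k)) l"
      using s_range unfolding normal_one_point_def by blast
    then show False
    proof cases
      case 1
      \<comment> \<open>Divergence fails on any small ball around \<open>(z0, 0)\<close>: it
        contains \<open>p k\<close> for large \<open>k\<close>, whose image under \<open>s k\<close>
        has norm at most 1.\<close>
      obtain e where e: "0 < e" "cball (z0, 0) e \<subseteq> U"
        using U open_contains_cball by blast
      have "\<forall>\<^sub>F k in sequentially. p k \<in> cball (z0, 0) e"
        using tendstoD[OF p e(1)] by eventually_elim (simp add: dist_commute less_imp_le)
      moreover have "\<forall>\<^sub>F k in sequentially. \<forall>x\<in>cball (z0, 0) e. 1 < norm (s k x)"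
        using 1 e(2) compact_cball unfolding diverges_compactly_def by blast
      ultimately have "\<forall>\<^sub>F k in sequentially. False"
      proof eventually_elim
        case (elim k)
        then have "1 < norm (s k (p k))" by blast
        then show False using s_p[of k] by (simp add: norm_prod_def)
      qed
      then show False by simp
    next
      case 2
      \<comment> \<open>Convergence already fails on the compact set \<open>{(z0, 0)}\<close>, whose
        images tend to infinity.\<close>
      have "(\<lambda>k. s (r k) (z0, 0)) \<longlonglongrightarrow> l (z0, 0)"
        using 2(2)[unfolded converges_compactly_def, rule_format, of "{(z0, 0)}"] U(2) by simp
      then have "(\<lambda>k. norm (s (r k) (z0, 0))) \<longlonglongrightarrow> norm (l (z0, 0))"
        by (rule tendsto_norm)
      moreover have "filterlim (\<lambda>k. norm (s (r k) (z0, 0))) at_top sequentially"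
        using filterlim_compose[OF norm_top filterlim_subseq[OF 2(1)]] by (simp add: s_base norm_prod_def)
      ultimately show False
        using not_tendsto_and_filterlim_at_infinity[OF sequentially_bot]
          filterlim_at_top_imp_at_infinity by blast
    qed
  qed
  moreover have "\<not> normal_projective U (range (\<lambda>n. skew_product f g h ^^ n))"
    if U: "open U" "(z0, 0) \<in> U" for U
  proof
    assume "normal_projective U (range (\<lambda>n. skew_product f g h ^^ n))"
    then obtain r l where rl: "strict_mono (r :: nat \<Rightarrow> nat)" "hol_cproj_on l U"
        "converges_compactly U (\<lambda>k x. to_plane (s (r k) x)) l"
      using s_range unfolding normal_projective_def by blast
    show False
      by (rule no_limit[OF rl(3) _ U rl(1) dist_to_plane_zero])
        (use rl(2) in \<open>auto simp: hol_cproj_on_def\<close>)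
  qed
  moreover have "\<not> normal_spheres U (range (\<lambda>n. skew_product f g h ^^ n))"
    if U: "open U" "(z0, 0) \<in> U" for U
  proof
    assume "normal_spheres U (range (\<lambda>n. skew_product f g h ^^ n))"
    then obtain r l where rl: "strict_mono (r :: nat \<Rightarrow> nat)" "hol_spheres_on l U"
        "converges_compactly U (\<lambda>k x. to_spheres (s (r k) x)) l"
      using s_range unfolding normal_spheres_def by blast
    have "continuous_on U (\<lambda>x. (fst (l x), snd (l x)))"
      using rl(2) unfolding hol_spheres_on_def hol_cproj_on_def by (intro continuous_on_Pair) auto
    then have "continuous_on U l" by simp
    \<comment> \<open>The distance on the product dominates that of the first components.\<close>
    moreover have "1/2 \<le> dist (to_spheres (z, 0)) (to_spheres (0, w))" if "1 \<le> norm z" for z w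
      using dist_to_sphere_zero[OF that] dist_fst_le[of "to_spheres (z, 0)" "to_spheres (0, w)"]
      by (simp add: to_spheres_def)
    ultimately show False
      by (intro no_limit[OF rl(3) _ U rl(1)])
  qed
  ultimately show ?thesis
    using h(1) unfolding julia_set_def fatou_set_def by blast
qed

end
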